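(* Let $X\in\mathbb{R}^{m\times s}$, $Y\in\mathbb{R}^{n\times s}$, $V^{(0)}\in\mathbb{R}^{q\times s}$, let $k_1,k_2$ be positive integers with $k_1+k_2=k\le\min\{m,n\}$, and for $i=0,1,\ldots$ let $D_1^{(0)},C_1^{(0)},D_2^{(i)},C_2^{(i)},V^{(i)}$ be determined by Algorithm MTT (described in the context) started from $V^{(0)}$. Let $$\varepsilon^{(i)}=f\bigl(D_1^{(0)},C_1^{(0)},D_2^{(i)},C_2^{(i)},V^{(i)}\bigr)$$ be the associated error. Then increasing the number of iterations decreases (does not increase) the associated error, i.e. $$\varepsilon^{(i+1)}\le\varepsilon^{(i)}\qquad\text{for all } i=0,1,\ldots$$
   Context: $\|\cdot\|$ is the Frobenius norm, $M^\dagger$ is the Moore–Penrose pseudo-inverse, and $G=I-Y^\dagger Y\in\mathbb{R}^{s\times s}$. The variables are $D_1\in\mathbb{R}^{m\times k_1}$, $C_1\in\mathbb{R}^{k_1\times n}$, $D_2\in\mathbb{R}^{m\times k_2}$, $C_2\in\mathbb{R}^{k_2\times q}$, $V\in\mathbb{R}^{q\times s}$. Define $$f(D_1,C_1,D_2,C_2,V)=\|X-[D_1C_1Y+D_2C_2VG]\|^2,\qquad f(D_2,C_2,V)=\|X-D_2C_2VG\|^2 .$$ Algorithm MTT. Input: $V^{(0)}$ (and a tolerance $\delta>0$). (1) Let $(D_1^{(0)},C_1^{(0)},D_2^{(0)},C_2^{(0)})$ be a solution of $\min_{D_1,C_1}\min_{D_2,C_2}f(D_1,C_1,D_2,C_2,V^{(0)})$,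 and set $\varepsilon^{(0)}=f(D_1^{(0)},C_1^{(0)},D_2^{(0)},C_2^{(0)},V^{(0)})$. (2) For $i=0,1,2,\ldots$: (a) let $\widetilde V$ be the minimal-norm solution of $\min_V f(D_2^{(i)},C_2^{(i)},V)$, namely $\widetilde V=(D_2^{(i)}C_2^{(i)})^\dagger XG^\dagger$, and set $\varepsilon_V^{(i+1)}=f(D_1^{(0)},C_1^{(0)},D_2^{(i)},C_2^{(i)},\widetilde V)$; (b) let $(\widetilde D_2,\widetilde C_2)$ be a solution of $\min_{D_2,C_2}f(D_2,C_2,V^{(i)})$, and set $\varepsilon_{D,C}^{(i+1)}=f(D_1^{(0)},C_1^{(0)},\widetilde D_2,\widetilde C_2,V^{(i)})$; (c) if $\varepsilon_{D,C}^{(i+1)}\le\varepsilon_V^{(i+1)}$, set $D_2^{(i+1)}=\widetilde D_2$, $C_2^{(i+1)}=\widetilde C_2$, $V^{(i+1)}=V^{(i)}$, $\varepsilon^{(i+1)}=\varepsilon_{D,C}^{(i+1)}$; otherwise set $D_2^{(i+1)}=D_2^{(i)}$, $C_2^{(i+1)}=C_2^{(i)}$, $V^{(i+1)}=\widetilde V$, $\varepsilon^{(i+1)}=\varepsilon_V^{(i+1)}$; (d) stop if $|\varepsilon^{(i+1)}-\varepsilon^{(i)}|\le\delta$. The assertion concerns every iteration $i$ that is performed (or all $i$ if the stopping test is disregarded). *)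

theory Defs
  imports "HOL-Analysis.Analysis" "HOL-Library.Extended_Nat"
begin

text \<open>
  The type \<open>real^'s^'m\<close> consists of the matrices with rows indexed by \<open>'m\<close> and columns indexed
  by \<open>'s\<close>. Its library norm and inner product are the Frobenius ones.
\<close>

lemma norm_matrix_eq_frobenius:
  fixes A :: "real^'s^'m"
  shows "norm A = sqrt (\<Sum>i\<in>UNIV. \<Sum>j\<in>UNIV. (A $ i $ j)\<^sup>2)"
  by (simp add: norm_vec_def L2_set_def sum_nonneg)

definition is_pinv :: "real^'s^'m \<Rightarrow> real^'m^'s \<Rightarrow> bool" where
  "is_pinv A B \<longleftrightarrow>
     A ** B ** A = A \<and> B ** A ** B = B \<and>
     transpose (A ** B) = A ** B \<and> transpose (B ** A) = B ** A"

definition pinv :: "real^'s^'m \<Rightarrow> real^'m^'s" where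
  "pinv A = (THE B. is_pinv A B)"

text \<open>The four Penrose equations have exactly one solution, so \<open>pinv\<close> is well defined.\<close>

lemma is_pinv_unique:
  assumes B: "is_pinv A B" and C: "is_pinv A C"
  shows "B = C"
proof -
  have b: "A ** B ** A = A" "B ** A ** B = B"
    "transpose (A ** B) = A ** B" "transpose (B ** A) = B ** A"
    using B by (auto simp: is_pinv_def)
  have c: "A ** C ** A = A" "C ** A ** C = C"
    "transpose (A ** C) = A ** C" "transpose (C ** A) = C ** A"
    using C by (auto simp: is_pinv_def)
  have "A ** B = transpose ((A ** C) ** (A ** B))"
    by (simp only: matrix_mul_assoc c(1) b(3))
  also have "\<dots> = (A ** B) ** (A ** C)"
    by (simp only: matrix_transpose_mul[of "A ** C" "A ** B"] b(3) c(3))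
  also have "\<dots> = A ** C" by (simp only: matrix_mul_assoc b(1))
  finally have AB: "A ** B = A ** C" .
  have "B ** A = B ** (A ** C ** A)" by (simp only: c(1))
  also have "\<dots> = (B ** A) ** (C ** A)" by (simp only: matrix_mul_assoc)
  also have "\<dots> = transpose ((C ** A) ** (B ** A))"
    by (simp only: matrix_transpose_mul[of "C ** A" "B ** A"] b(4) c(4))
  also have "(C ** A) ** (B ** A) = C ** (A ** B ** A)" by (simp only: matrix_mul_assoc)
  finally have BA: "B ** A = C ** A" by (simp only: b(1) c(4))
  have "B = C ** A ** B" using b(2) by (simp only: BA)
  also have "\<dots> = C ** (A ** B)" by (simp only: matrix_mul_assoc)
  also have "\<dots> = C ** A ** C" by (simp only: AB matrix_mul_assoc)
  also have "\<dots> = C" by (rule c(2))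
  finally show ?thesis .
qed

lemma matrix_eq_of_range:
  fixes M :: "real^'a^'b" and N :: "real^'c^'b"
  assumes "\<And>y. \<exists>u. M *v u = N *v y"
  shows "\<exists>U. M ** U = N"
proof -
  obtain u where u: "\<And>y. M *v u y = N *v y" using assms by metis
  define U :: "real^'c^'a" where "U = (\<chi> i j. u (axis j 1) $ i)"
  have "(M ** U) $ i $ j = N $ i $ j" for i j
  proof -
    have "(M ** U) $ i $ j = (M *v u (axis j 1)) $ i"
      by (simp add: U_def matrix_matrix_mult_def matrix_vector_mult_def)
    also have "\<dots> = N $ i $ j"
      by (simp add: u matrix_vector_mult_basis column_def)
    finally show ?thesis .
  qed
  then show ?thesis by (auto simp: vec_eq_iff)
qed

lemma range_kernel_decomp:
  fixes A :: "real^'s^'m"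
  shows "\<exists>z r. y = A *v z + r \<and> transpose A *v r = 0"
proof -
  obtain a r where a: "a \<in> span (range ((*v) A))"
    and r: "\<And>w. w \<in> span (range ((*v) A)) \<Longrightarrow> orthogonal r w" and y: "y = a + r"
    using orthogonal_subspace_decomp_exists[of "range ((*v) A)" y] by blast
  have "span (range ((*v) A)) = range ((*v) A)"
    by (simp add: span_eq_iff linear_subspace_image)
  then obtain z where z: "a = A *v z" using a by blast
  have "inner (transpose A *v r) x = 0" for x
    using r[OF span_base[of "A *v x"]] by (simp add: orthogonal_def dot_lmul_matrix)
  then have "transpose A *v r = 0" using inner_eq_zero_iff by blast
  then show ?thesis using y z by blast
qed

lemma is_pinv_exists: "\<exists>B. is_pinv A B"
proof -
  have "\<exists>u. (transpose A ** A ** transpose A) *v u = transpose A *v y" for y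
  proof -
    obtain z r where y: "y = A *v z + r" "transpose A *v r = 0"
      using range_kernel_decomp by blast
    obtain u n where z: "z = transpose A *v u + n" "A *v n = 0"
      using range_kernel_decomp[of z "transpose A"] by auto
    have "transpose A *v y = transpose A *v (A *v (transpose A *v u))"
      by (simp only: y z matrix_vector_right_distrib add_0_right)
    then show ?thesis by (metis matrix_vector_mul_assoc)
  qed
  then obtain U where U: "transpose A ** A ** transpose A ** U = transpose A"
    using matrix_eq_of_range by blast
  define Z where "Z = transpose A ** U"
  have 1: "transpose A ** (A ** Z) = transpose A"
    using U by (simp only: Z_def matrix_mul_assoc)
  have 2: "transpose (A ** Z) ** A = A"
    using arg_cong[OF 1, of transpose]
    by (simp only: matrix_transpose_mul[of "transpose A" "A ** Z"] transpose_transpose)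
  have "A ** Z = transpose (A ** Z) ** A ** Z" by (simp only: 2)
  also have "\<dots> = transpose (A ** Z) ** (A ** Z)" by (simp only: matrix_mul_assoc)
  finally have 3: "A ** Z = transpose (A ** Z) ** (A ** Z)" .
  have "transpose (A ** Z) = transpose (A ** Z) ** (A ** Z)"
    using arg_cong[OF 3, of transpose]
    by (simp only: matrix_transpose_mul[of "transpose (A ** Z)" "A ** Z"] transpose_transpose)
  from trans[OF this 3[symmetric]] have AZ: "transpose (A ** Z) = A ** Z" .
  have AZA: "A ** Z ** A = A" using 2 by (simp only: AZ)
  have ZAt: "transpose (Z ** A) = transpose (U ** A) ** A"
    by (simp only: Z_def matrix_transpose_mul transpose_transpose matrix_mul_assoc)
  have "transpose (Z ** A) ** (Z ** A) = transpose (U ** A) ** (A ** Z ** A)"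
    by (simp only: ZAt matrix_mul_assoc)
  then have 4: "transpose (Z ** A) = transpose (Z ** A) ** (Z ** A)"
    by (simp only: AZA ZAt)
  have "Z ** A = transpose (Z ** A) ** (Z ** A)"
    using arg_cong[OF 4, of transpose]
    by (simp only: matrix_transpose_mul[of "transpose (Z ** A)" "Z ** A"] transpose_transpose)
  from trans[OF 4 this[symmetric]] have ZA: "transpose (Z ** A) = Z ** A" .
  have "Z ** A ** transpose A = transpose (A ** (Z ** A))"
    by (simp only: matrix_transpose_mul[of A "Z ** A"] ZA)
  also have "\<dots> = transpose A" by (simp only: matrix_mul_assoc AZA)
  finally have "Z ** A ** Z = Z" by (simp only: Z_def matrix_mul_assoc)
  then have "is_pinv A Z" using AZ AZA ZA by (simp only: is_pinv_def simp_thms)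
  then show ?thesis ..
qed

lemma is_pinv_pinv: "is_pinv A (pinv A)"
  unfolding pinv_def by (rule theI') (use is_pinv_exists is_pinv_unique in blast)

definition proj_G :: "real^'s^'n \<Rightarrow> real^'s^'s" where
  "proj_G Y = mat 1 - pinv Y ** Y"

definition err :: "real^'s^'m \<Rightarrow> real^'s^'n \<Rightarrow> real^'k1^'m \<Rightarrow> real^'n^'k1 \<Rightarrow>
    real^'k2^'m \<Rightarrow> real^'q^'k2 \<Rightarrow> real^'s^'q \<Rightarrow> real" where
  "err X Y D1 C1 D2 C2 V =
     (norm (X - (D1 ** C1 ** Y + D2 ** C2 ** V ** proj_G Y)))\<^sup>2"

definition err2 :: "real^'s^'m \<Rightarrow> real^'s^'n \<Rightarrow>
    real^'k2^'m \<Rightarrow> real^'q^'k2 \<Rightarrow> real^'s^'q \<Rightarrow> real" where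
  "err2 X Y D2 C2 V = (norm (X - D2 ** C2 ** V ** proj_G Y))\<^sup>2"

definition V_tilde :: "real^'s^'m \<Rightarrow> real^'s^'n \<Rightarrow>
    real^'k2^'m \<Rightarrow> real^'q^'k2 \<Rightarrow> real^'s^'q" where
  "V_tilde X Y D2 C2 = pinv (D2 ** C2) ** X ** pinv (proj_G Y)"

definition is_min_norm_solution :: "('a::real_normed_vector \<Rightarrow> real) \<Rightarrow> 'a \<Rightarrow> bool" where
  "is_min_norm_solution g v \<longleftrightarrow> is_arg_min norm (is_arg_min g (\<lambda>_. True)) v"

text \<open>
  \<open>V_tilde\<close> is given by its closed form; the following lemmas show that it is the unique
  minimal-norm minimiser of \<open>err2\<close> in its last argument.
\<close>

lemma matrix_diff_ldistrib: "(A :: real^'a^'b) ** (B - C) = A ** B - A ** C"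
  by (simp add: vec_eq_iff matrix_matrix_mult_def right_diff_distrib sum_subtractf)

lemma matrix_diff_rdistrib: "((B :: real^'a^'b) - C) ** A = B ** A - C ** A"
  by (simp add: vec_eq_iff matrix_matrix_mult_def left_diff_distrib sum_subtractf)

lemma inner_matrix_mult_left:
  fixes A :: "real^'b^'a" and P :: "real^'c^'b"
  shows "inner (A ** P) Q = inner P (transpose A ** Q)"
proof -
  have "inner (A ** P) Q = (\<Sum>i\<in>UNIV. \<Sum>j\<in>UNIV. \<Sum>k\<in>UNIV. A $ i $ k * P $ k $ j * Q $ i $ j)"
    by (simp add: inner_vec_def matrix_matrix_mult_def sum_distrib_right)
  also have "\<dots> = (\<Sum>i\<in>UNIV. \<Sum>k\<in>UNIV. \<Sum>j\<in>UNIV. A $ i $ k * P $ k $ j * Q $ i $ j)"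
    by (rule sum.cong[OF refl], rule sum.swap)
  also have "\<dots> = (\<Sum>k\<in>UNIV. \<Sum>i\<in>UNIV. \<Sum>j\<in>UNIV. A $ i $ k * P $ k $ j * Q $ i $ j)"
    by (rule sum.swap)
  also have "\<dots> = (\<Sum>k\<in>UNIV. \<Sum>j\<in>UNIV. \<Sum>i\<in>UNIV. A $ i $ k * P $ k $ j * Q $ i $ j)"
    by (rule sum.cong[OF refl], rule sum.swap)
  also have "\<dots> = inner P (transpose A ** Q)"
    by (simp add: inner_vec_def matrix_matrix_mult_def transpose_def sum_distrib_left mult_ac)
  finally show ?thesis .
qed

lemma inner_transpose: "inner (transpose P) (transpose Q) = inner (P :: real^'a^'b) Q"
  unfolding inner_vec_def transpose_def by simp (rule sum.swap)

lemma inner_matrix_mult_right: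
  fixes P :: "real^'b^'a" and B :: "real^'c^'b"
  shows "inner (P ** B) Q = inner P (Q ** transpose B)"
proof -
  have "inner (P ** B) Q = inner (transpose B ** transpose P) (transpose Q)"
    using inner_transpose[of "P ** B" Q] by (simp only: matrix_transpose_mul)
  also have "\<dots> = inner (transpose P) (transpose (Q ** transpose B))"
    by (simp only: inner_matrix_mult_left matrix_transpose_mul transpose_transpose)
  also have "\<dots> = inner P (Q ** transpose B)" by (rule inner_transpose)
  finally show ?thesis .
qed

lemma is_min_norm_solution_iff_pinv:
  fixes A :: "real^'q^'m" and B :: "real^'s^'t" and X :: "real^'s^'m"
  shows "is_min_norm_solution (\<lambda>V. (norm (X - A ** V ** B))\<^sup>2) V \<longleftrightarrow> V = pinv A ** X ** pinv B"
proof -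
  define g where "g = (\<lambda>V. (norm (X - A ** V ** B))\<^sup>2)"
  define W where "W = pinv A ** X ** pinv B"
  have A: "A ** pinv A ** A = A" "pinv A ** A ** pinv A = pinv A"
    "transpose (A ** pinv A) = A ** pinv A" "transpose (pinv A ** A) = pinv A ** A"
    using is_pinv_pinv[of A] by (auto simp: is_pinv_def)
  have B: "B ** pinv B ** B = B" "pinv B ** B ** pinv B = pinv B"
    "transpose (B ** pinv B) = B ** pinv B" "transpose (pinv B ** B) = pinv B ** B"
    using is_pinv_pinv[of B] by (auto simp: is_pinv_def)
  have pyth: "g V = g W + (norm (A ** (W - V) ** B))\<^sup>2" for V
  proof -
    have At: "transpose A ** A ** pinv A = transpose A"
    proof -
      have "transpose A = transpose (A ** pinv A ** A)" by (simp only: A(1))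
      also have "\<dots> = transpose A ** (A ** pinv A)"
        by (simp only: matrix_transpose_mul[of "A ** pinv A" A] A(3))
      finally show ?thesis by (simp only: matrix_mul_assoc)
    qed
    have Bt: "pinv B ** (B ** transpose B) = transpose B"
    proof -
      have "transpose B = transpose (B ** (pinv B ** B))" by (simp only: B(1) matrix_mul_assoc)
      also have "\<dots> = pinv B ** B ** transpose B"
        by (simp only: matrix_transpose_mul[of B "pinv B ** B"] B(4))
      finally show ?thesis by (simp only: matrix_mul_assoc)
    qed
    have "transpose A ** (A ** W ** B) ** transpose B
        = (transpose A ** A ** pinv A) ** X ** (pinv B ** (B ** transpose B))"
      by (simp only: W_def matrix_mul_assoc)
    then have "transpose A ** (X - A ** W ** B) ** transpose B = 0"
      by (simp only: At Bt matrix_diff_ldistrib matrix_diff_rdistrib diff_self)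
    then have "inner (A ** (W - V) ** B) (X - A ** W ** B) = 0"
      by (simp only: inner_matrix_mult_right[of "A ** (W - V)"] inner_matrix_mult_left[of A]
        inner_zero_right matrix_mul_assoc)
    then have "orthogonal (X - A ** W ** B) (A ** (W - V) ** B)"
      by (simp add: orthogonal_def inner_commute)
    from norm_add_Pythagorean[OF this] show ?thesis
      by (simp add: g_def matrix_diff_ldistrib matrix_diff_rdistrib)
  qed
  have amin: "is_arg_min g (\<lambda>_. True) V \<longleftrightarrow> A ** (W - V) ** B = 0" for V
  proof
    assume "is_arg_min g (\<lambda>_. True) V"
    then have "g V \<le> g W" by (simp add: is_arg_min_linorder)
    then show "A ** (W - V) ** B = 0" using pyth[of V] by simp
  next
    assume "A ** (W - V) ** B = 0"
    then have "g V = g W" using pyth[of V] by simp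
    moreover have "g W \<le> g U" for U using pyth[of U] by simp
    ultimately show "is_arg_min g (\<lambda>_. True) V" by (simp add: is_arg_min_linorder)
  qed
  have nrm: "(norm V)\<^sup>2 = (norm W)\<^sup>2 + (norm (V - W))\<^sup>2" if "is_arg_min g (\<lambda>_. True) V" for V
  proof -
    have z: "A ** (V - W) ** B = 0"
      using that unfolding amin by (simp add: matrix_diff_ldistrib matrix_diff_rdistrib)
    have "(pinv A ** A) ** W ** (B ** pinv B)
        = (pinv A ** A ** pinv A) ** X ** (pinv B ** B ** pinv B)"
      by (simp only: W_def matrix_mul_assoc)
    then have "(pinv A ** A) ** W ** (B ** pinv B) = W" by (simp only: A(2) B(2) W_def)
    then have "inner W (V - W) = inner ((pinv A ** A) ** W ** (B ** pinv B)) (V - W)"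
      by simp
    also have "\<dots> = inner W ((pinv A ** A) ** ((V - W) ** (B ** pinv B)))"
      by (simp only: inner_matrix_mult_right[of "(pinv A ** A) ** W"]
        inner_matrix_mult_left[of "pinv A ** A"] A(4) B(3))
    also have "\<dots> = inner W (pinv A ** (A ** (V - W) ** B) ** pinv B)"
      by (simp add: matrix_mul_assoc)
    also have "\<dots> = 0" by (simp add: z)
    finally have "orthogonal W (V - W)" by (simp add: orthogonal_def)
    from norm_add_Pythagorean[OF this] show ?thesis by simp
  qed
  have W: "is_arg_min g (\<lambda>_. True) W" by (simp add: amin)
  have "is_min_norm_solution g V \<longleftrightarrow> V = W"
  proof
    assume "is_min_norm_solution g V"
    then have V: "is_arg_min g (\<lambda>_. True) V" and "norm V \<le> norm W"
      using W by (auto simp: is_min_norm_solution_def is_arg_min_linorder)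
    then have "(norm V)\<^sup>2 \<le> (norm W)\<^sup>2" by (simp add: power_mono)
    then show "V = W" using nrm[OF V] by simp
  next
    assume "V = W"
    moreover have "norm W \<le> norm U" if "is_arg_min g (\<lambda>_. True) U" for U
      by (rule power2_le_imp_le) (simp_all add: nrm[OF that])
    ultimately show "is_min_norm_solution g V"
      using W unfolding is_min_norm_solution_def is_arg_min_linorder[of norm] by blast
  qed
  then show ?thesis by (simp add: g_def W_def)
qed

lemma V_tilde_min_norm_solution:
  "is_min_norm_solution (err2 X Y D2 C2) V \<longleftrightarrow> V = V_tilde X Y D2 C2"
  using is_min_norm_solution_iff_pinv[of X "D2 ** C2" "proj_G Y" V]
  by (simp add: err2_def[abs_def] V_tilde_def)

text \<open>
  Minimisers are in general not unique and the algorithm may return any of them, so it is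
  modelled by relations. \<open>mtt_step X Y D1 C1 (D2, C2, V) (D2', C2', V')\<close> is one iteration.
\<close>

definition mtt_init :: "real^'s^'m \<Rightarrow> real^'s^'n \<Rightarrow> real^'s^'q \<Rightarrow>
    real^'k1^'m \<Rightarrow> real^'n^'k1 \<Rightarrow> real^'k2^'m \<Rightarrow> real^'q^'k2 \<Rightarrow> bool" where
  "mtt_init X Y V0 D1 C1 D2 C2 \<longleftrightarrow>
     is_arg_min (\<lambda>(D1, C1, D2, C2). err X Y D1 C1 D2 C2 V0) (\<lambda>_. True) (D1, C1, D2, C2)"

definition mtt_step :: "real^'s^'m \<Rightarrow> real^'s^'n \<Rightarrow> real^'k1^'m \<Rightarrow> real^'n^'k1 \<Rightarrow>
    (real^'k2^'m) \<times> (real^'q^'k2) \<times> (real^'s^'q) \<Rightarrow>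
    (real^'k2^'m) \<times> (real^'q^'k2) \<times> (real^'s^'q) \<Rightarrow> bool" where
  "mtt_step X Y D1 C1 = (\<lambda>(D2, C2, V) next_state.
     \<exists>Dt Ct. is_arg_min (\<lambda>(D, C). err2 X Y D C V) (\<lambda>_. True) (Dt, Ct) \<and>
       (let Vt = V_tilde X Y D2 C2;
            err_V = err X Y D1 C1 D2 C2 Vt;
            err_DC = err X Y D1 C1 Dt Ct V
        in next_state = (if err_DC \<le> err_V then (Dt, Ct, V) else (D2, C2, Vt))))"

text \<open>
  A run performs \<open>N\<close> iterations, numbered from \<open>0\<close>; the sequences are constrained only up to
  index \<open>N\<close>. The run of the algorithm with tolerance \<open>\<delta>\<close> is the case where \<open>N\<close> is determined
  by the stopping test, and \<open>N = \<infinity>\<close> is the algorithm without the test.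
\<close>

definition mtt_run :: "real^'s^'m \<Rightarrow> real^'s^'n \<Rightarrow> real^'s^'q \<Rightarrow> enat \<Rightarrow>
    real^'k1^'m \<Rightarrow> real^'n^'k1 \<Rightarrow>
    (nat \<Rightarrow> real^'k2^'m) \<Rightarrow> (nat \<Rightarrow> real^'q^'k2) \<Rightarrow> (nat \<Rightarrow> real^'s^'q) \<Rightarrow> bool" where
  "mtt_run X Y V0 N D1 C1 D2 C2 V \<longleftrightarrow>
     V 0 = V0 \<and> mtt_init X Y V0 D1 C1 (D2 0) (C2 0) \<and>
     (\<forall>i. enat i < N \<longrightarrow>
        mtt_step X Y D1 C1 (D2 i, C2 i, V i) (D2 (Suc i), C2 (Suc i), V (Suc i)))"

end

theory Submission
  imports Defs
begin

text \<open>
  Both subproblems of an iteration minimise the reduced error \<open>err2\<close>, in which the block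
  \<open>D\<^sub>1 C\<^sub>1\<close> is absent, whereas the claim concerns the full error \<open>err\<close>. The two are compatible
  because \<open>G = I - Y\<^sup>\<dagger> Y\<close> is the orthogonal projection onto the kernel of \<open>Y\<close>: the matrices
  \<open>P Y\<close> and \<open>W G\<close> are always orthogonal for the Frobenius inner product, so expanding the square
  leaves no cross term between the two blocks, and \<open>err - err2\<close> depends only on \<open>D\<^sub>1, C\<^sub>1\<close>
  (lemma \<open>err_eq_err2_plus_const\<close>).

  As \<open>D\<^sub>1, C\<^sub>1\<close> stay fixed after the initialisation, a minimiser of \<open>err2\<close> is then a minimiser of
  \<open>err\<close>. Each of the two candidates of an iteration minimises over a set of choices that
  contains the current state, so whichever of them is kept, the error has not grown.
\<close>

lemma transpose_diff: "transpose (A - B) = transpose A - transpose (B :: real^'a^'b)"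
  by (simp add: transpose_def vec_eq_iff)

lemma transpose_proj_G: "transpose (proj_G Y) = proj_G Y"
proof -
  have "transpose (pinv Y ** Y) = pinv Y ** Y"
    using is_pinv_pinv[of Y] by (simp add: is_pinv_def)
  then show ?thesis
    by (simp add: proj_G_def transpose_diff)
qed

lemma mult_proj_G: "Y ** proj_G Y = 0"
proof -
  have "Y ** pinv Y ** Y = Y"
    using is_pinv_pinv[of Y] by (simp add: is_pinv_def)
  then show ?thesis
    by (simp add: proj_G_def matrix_diff_ldistrib matrix_mul_assoc)
qed

text \<open>
  The rows of \<open>P ** Y\<close> lie in the row space of \<open>Y\<close>, those of \<open>W ** proj_G Y\<close> in its orthogonal
  complement.
\<close>

lemma inner_mult_proj_G_eq_0:
  fixes Y :: "real^'s^'n" and P :: "real^'n^'m" and W :: "real^'s^'m"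
  shows "inner (W ** proj_G Y) (P ** Y) = 0"
proof -
  have "inner (W ** proj_G Y) (P ** Y) = inner W (P ** Y ** proj_G Y)"
    by (simp only: inner_matrix_mult_right transpose_proj_G)
  also have "P ** Y ** proj_G Y = P ** (Y ** proj_G Y)"
    by (simp only: matrix_mul_assoc)
  finally show ?thesis by (simp add: mult_proj_G)
qed

text \<open>
  Only the inner product with \<open>X\<close> survives in the mixed terms, so the difference of the two errors
  is the same for all \<open>D\<^sub>2, C\<^sub>2, V\<close>.
\<close>

lemma err_eq_err2_plus_const:
  "err X Y D1 C1 D2 C2 V
     = err2 X Y D2 C2 V + ((norm (D1 ** C1 ** Y))\<^sup>2 - 2 * inner X (D1 ** C1 ** Y))"
proof -
  let ?R = "X - D2 ** C2 ** V ** proj_G Y"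
  have "err X Y D1 C1 D2 C2 V = (norm (?R - D1 ** C1 ** Y))\<^sup>2"
    by (simp add: err_def algebra_simps)
  also have "\<dots> = (norm ?R)\<^sup>2 + (norm (D1 ** C1 ** Y))\<^sup>2 - 2 * inner ?R (D1 ** C1 ** Y)"
    by (simp add: power2_norm_eq_inner inner_diff_left inner_diff_right inner_commute)
  also have "inner ?R (D1 ** C1 ** Y) = inner X (D1 ** C1 ** Y)"
    by (simp add: inner_diff_left inner_mult_proj_G_eq_0)
  finally show ?thesis by (simp add: err2_def)
qed

lemma err_le_iff_err2_le:
  "err X Y D1 C1 D2 C2 V \<le> err X Y D1 C1 D2' C2' V'
     \<longleftrightarrow> err2 X Y D2 C2 V \<le> err2 X Y D2' C2' V'"
  by (simp add: err_eq_err2_plus_const)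

lemma err2_V_tilde_le: "err2 X Y D2 C2 (V_tilde X Y D2 C2) \<le> err2 X Y D2 C2 V"
  using V_tilde_min_norm_solution[of X Y D2 C2 "V_tilde X Y D2 C2"]
  by (simp add: is_min_norm_solution_def is_arg_min_linorder)

lemma mtt_step_err_le:
  assumes "mtt_step X Y D1 C1 (D2, C2, V) (D2', C2', V')"
  shows "err X Y D1 C1 D2' C2' V' \<le> err X Y D1 C1 D2 C2 V"
proof -
  obtain Dt Ct where
    min: "is_arg_min (\<lambda>(D, C). err2 X Y D C V) (\<lambda>_. True) (Dt, Ct)" and
    new: "(D2', C2', V') = (Dt, Ct, V) \<or> (D2', C2', V') = (D2, C2, V_tilde X Y D2 C2)"
    using assms unfolding mtt_step_def Let_def by (auto split: if_splits)
  have "err2 X Y Dt Ct V \<le> err2 X Y D2 C2 V"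
    using min by (auto simp: is_arg_min_linorder)
  then show ?thesis
    using new err2_V_tilde_le[of X Y D2 C2 V] by (auto simp: err_le_iff_err2_le)
qed

theorem theorem2:
  fixes X :: "real^'s^'m" and Y :: "real^'s^'n" and V0 :: "real^'s^'q"
    and D1 :: "real^'k1^'m" and C1 :: "real^'n^'k1"
    and D2 :: "nat \<Rightarrow> real^'k2^'m" and C2 :: "nat \<Rightarrow> real^'q^'k2" and V :: "nat \<Rightarrow> real^'s^'q"
    and \<epsilon> :: "nat \<Rightarrow> real" and k :: nat and N :: enat
  assumes "CARD('k1) + CARD('k2) = k" and "k \<le> min CARD('m) CARD('n)"
    and "mtt_run X Y V0 N D1 C1 D2 C2 V"
    and "\<And>i. \<epsilon> i = err X Y D1 C1 (D2 i) (C2 i) (V i)"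
  shows "\<forall>i. enat i < N \<longrightarrow> \<epsilon> (Suc i) \<le> \<epsilon> i"
  using assms(3) by (auto simp: assms(4) mtt_run_def intro: mtt_step_err_le)

end
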